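(* Let $d\ge1$, let $m_1,\dots,m_d,n_1,\dots,n_d$ be positive integers, $q_k=m_kn_k$ for $k=1,\dots,d$, and let $\mathcal{A}\in\mathbb{R}^{q_1\times\cdots\times q_d}$ be a hypermatrix. Let $m=\prod_{k=1}^d m_k$ and $n=\prod_{k=1}^d n_k$. Then there exist hypermatrices $\mathcal{B}\in\mathbb{R}^{m_1\times\cdots\times m_d}$ and $\mathcal{C}\in\mathbb{R}^{n_1\times\cdots\times n_d}$ with $\mathcal{A}=\mathcal{B}\otimes_d\mathcal{C}$ if and only if the vector $$V:=\Psi^{\mathrm T}V(\mathcal{A})\in\mathbb{R}^{mn}$$ is decomposable with respect to $m\times n$, i.e. there exist $y\in\mathbb{R}^m$, $z\in\mathbb{R}^n$ with $V=y\otimes z$.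
   Context: A hypermatrix $\mathcal{A}\in\mathbb{R}^{q_1\times\cdots\times q_d}$ of order $d$ is a family of reals $(a_{k_1,\dots,k_d})$ with $1\le k_s\le q_s$. Its vector form $V(\mathcal{A})\in\mathbb{R}^{q_1\cdots q_d}$ is the column vector of its entries arranged in lexicographic order of $(k_1,\dots,k_d)$ (last index varying fastest). Paired Kronecker product: for $\mathcal{B}=(b_{i_1,\dots,i_d})\in\mathbb{R}^{m_1\times\cdots\times m_d}$ and $\mathcal{C}=(c_{j_1,\dots,j_d})\in\mathbb{R}^{n_1\times\cdots\times n_d}$, $\mathcal{B}\otimes_d\mathcal{C}=(a_{k_1,\dots,k_d})\in\mathbb{R}^{m_1n_1\times\cdots\times m_dn_d}$ where $a_{k_1,\dots,k_d}=b_{i_1,\dots,i_d}c_{j_1,\dots,j_d}$ with $k_s=(i_s-1)n_s+j_s$, $s=1,\dots,d$. $\Psi$ is the $mn\times mn$ permutation matrix that rearranges entries from the order $(i_1,\dots,i_d,j_1,\dots,j_d)$ to the order $(i_1,j_1,i_2,j_2,\dots,i_d,j_d)$ (both lexicographic), where $i_s\in\{1,\dots,m_s\}$, $j_s\in\{1,\dots,n_s\}$; that is, with $\delta_r^i$ the $i$-th column of $I_r$, for all indices $$\Psi\left(\delta_{m_1}^{i_1}\otimes\cdots\otimes\delta_{m_d}^{i_d}\otimes\delta_{n_1}^{j_1}\otimes\cdots\otimes\delta_{n_d}^{j_d}\right)=\delta_{m_1}^{i_1}\otimes\delta_{n_1}^{j_1}\otimes\cdots\otimes\delta_{m_d}^{i_d}\otimes\delta_{n_d}^{j_d}.$$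 $\otimes$ is the Kronecker product. *)

theory Defs
  imports "Jordan_Normal_Form.Matrix" "HOL-Library.FuncSet"
begin

text \<open>
  Vectors and matrices are indexed from 0, and so are hypermatrices here: the index
  \<open>k\<^sub>s\<close> ranges over \<open>0, ..., q\<^sub>s - 1\<close> instead of \<open>1, ..., q\<^sub>s\<close>, so that the rule
  \<open>k\<^sub>s = (i\<^sub>s - 1) n\<^sub>s + j\<^sub>s\<close> becomes \<open>k\<^sub>s = i\<^sub>s n\<^sub>s + j\<^sub>s\<close>.
\<close>

definition multi_indices :: "nat list \<Rightarrow> nat list set" where
  "multi_indices q = {k. length k = length q \<and> (\<forall>s<length q. k ! s < q ! s)}"

text \<open>Lexicographic enumeration, with the last index varying fastest.\<close>

definition multi_index_list :: "nat list \<Rightarrow> nat list list" where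
  "multi_index_list q = product_lists (map (\<lambda>r. [0..<r]) q)"

text \<open>
  A hypermatrix is an extensional function on its index set, so that equality of
  hypermatrices of the same size is equality of functions.
\<close>

definition hypermatrices :: "nat list \<Rightarrow> (nat list \<Rightarrow> real) set" where
  "hypermatrices q = multi_indices q \<rightarrow>\<^sub>E UNIV"

definition vector_form :: "nat list \<Rightarrow> (nat list \<Rightarrow> real) \<Rightarrow> real vec" where
  "vector_form q A = vec_of_list (map A (multi_index_list q))"

text \<open>
  The sizes of the factors are \<open>m\<close> and \<open>n\<close>. Division and remainder recover \<open>i\<^sub>s\<close>
  and \<open>j\<^sub>s\<close> from \<open>k\<^sub>s = i\<^sub>s n\<^sub>s + j\<^sub>s\<close>; see \<open>paired_kron_apply\<close> below.
\<close>

definition paired_kron ::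
  "nat list \<Rightarrow> nat list \<Rightarrow> (nat list \<Rightarrow> real) \<Rightarrow> (nat list \<Rightarrow> real) \<Rightarrow> nat list \<Rightarrow> real" where
  "paired_kron m n B C =
     (\<lambda>k\<in>multi_indices (map2 (*) m n). B (map2 (div) k n) * C (map2 (mod) k n))"

definition kron_vec :: "real vec \<Rightarrow> real vec \<Rightarrow> real vec" where
  "kron_vec y z =
     vec (dim_vec y * dim_vec z) (\<lambda>k. y $ (k div dim_vec z) * z $ (k mod dim_vec z))"

definition kron_vecs :: "real vec list \<Rightarrow> real vec" where
  "kron_vecs vs = foldr kron_vec vs (unit_vec 1 0)"

definition decomposable :: "nat \<Rightarrow> nat \<Rightarrow> real vec \<Rightarrow> bool" where
  "decomposable m n v \<longleftrightarrow> (\<exists>y\<in>carrier_vec m. \<exists>z\<in>carrier_vec n. v = kron_vec y z)"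

text \<open>
  Column \<open>c\<close> belongs to the \<open>c\<close>-th multi-index \<open>(i\<^sub>1, ..., i\<^sub>d, j\<^sub>1, ..., j\<^sub>d)\<close>, row \<open>r\<close> to
  the \<open>r\<close>-th multi-index \<open>(i\<^sub>1, j\<^sub>1, ..., i\<^sub>d, j\<^sub>d)\<close>. The action on Kronecker
  products of unit vectors is \<open>Psi_kron_unit_vecs\<close> below.
\<close>

definition Psi :: "nat list \<Rightarrow> nat list \<Rightarrow> real mat" where
  "Psi m n = mat (prod_list m * prod_list n) (prod_list m * prod_list n) (\<lambda>(r, c).
     let ij = multi_index_list (m @ n) ! c
     in if multi_index_list (splice m n) ! r = splice (take (length m) ij) (drop (length m) ij)
        then 1 else 0)"


lemma multi_indices_Nil: "multi_indices [] = {[]}"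
  by (auto simp: multi_indices_def)

lemma multi_indices_Cons:
  "x # k \<in> multi_indices (r # q) \<longleftrightarrow> x < r \<and> k \<in> multi_indices q"
  by (auto simp: multi_indices_def less_Suc_eq_0_disj)

lemma set_multi_index_list: "set (multi_index_list q) = multi_indices q"
proof (induction q)
  case Nil
  show ?case by (simp add: multi_index_list_def multi_indices_Nil)
next
  case (Cons r q)
  have "k \<in> set (multi_index_list (r # q)) \<longleftrightarrow> k \<in> multi_indices (r # q)" for k
  proof (cases k)
    case Nil
    then show ?thesis by (auto simp: multi_index_list_def multi_indices_def)
  next
    case (Cons x k')
    have "k \<in> set (multi_index_list (r # q)) \<longleftrightarrow> x < r \<and> k' \<in> set (multi_index_list q)"
      unfolding Cons by (auto simp: multi_index_list_def)
    then show ?thesis using Cons.IH Cons by (simp add: multi_indices_Cons)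
  qed
  then show ?case by blast
qed

lemma length_multi_index_list: "length (multi_index_list q) = prod_list q"
  by (induction q) (simp_all add: multi_index_list_def length_concat comp_def sum_list_triv)

lemma distinct_multi_index_list: "distinct (multi_index_list q)"
  unfolding multi_index_list_def by (rule distinct_product_lists) auto

lemma nth_concat_uniform:
  assumes "\<And>x. x \<in> set xs \<Longrightarrow> length (f x) = p" and "c < length xs * p"
  shows "concat (map f xs) ! c = f (xs ! (c div p)) ! (c mod p)"
  using assms
proof (induction xs arbitrary: c)
  case Nil
  then show ?case by simp
next
  case (Cons x xs)
  have p: "0 < p" using Cons.prems(2) by (cases p) auto
  show ?case
  proof (cases "c < p")
    case True
    then show ?thesis using Cons.prems(1) by (simp add: nth_append)
  next
    case False
    then have "c - p < length xs * p" using Cons.prems(2) by simp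
    with Cons have "concat (map f xs) ! (c - p) = f (xs ! ((c - p) div p)) ! ((c - p) mod p)"
      by simp
    with False p Cons.prems(1) show ?thesis
      by (simp add: nth_append le_div_geq le_mod_geq)
  qed
qed

lemma nth_multi_index_list_Cons:
  assumes "c < r * prod_list q"
  shows "multi_index_list (r # q) ! c =
         (c div prod_list q) # (multi_index_list q ! (c mod prod_list q))"
proof -
  have "0 < prod_list q" using assms by (cases "prod_list q") auto
  moreover have "c div prod_list q < r"
    using assms by (simp add: less_mult_imp_div_less)
  moreover have "multi_index_list (r # q) =
      concat (map (\<lambda>x. map (Cons x) (multi_index_list q)) [0..<r])"
    by (simp add: multi_index_list_def)
  ultimately show ?thesis
    using assms by (simp add: nth_concat_uniform[where p = "prod_list q"] length_multi_index_list)
qed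

lemma dim_vector_form: "dim_vec (vector_form q A) = prod_list q"
  by (simp add: vector_form_def length_multi_index_list)

lemma paired_kron_apply:
  assumes i: "i \<in> multi_indices m" and j: "j \<in> multi_indices n" and l: "length m = length n"
  shows "paired_kron m n B C (map2 (\<lambda>(i, j) n. i * n + j) (zip i j) n) = B i * C j"
proof -
  let ?k = "map2 (\<lambda>(i, j) n. i * n + j) (zip i j) n"
  have li: "length i = length n" and lj: "length j = length n"
    using i j l by (auto simp: multi_indices_def)
  have a: "i ! s < m ! s" "j ! s < n ! s" if "s < length n" for s
    using i j l that by (auto simp: multi_indices_def)
  have dv: "(i ! s * n ! s + j ! s) div n ! s = i ! s" if "s < length n" for s
    using a(2)[OF that] by (metis add.commute add_0 div_less div_mult_self1 less_nat_zero_code)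
  have "i ! s * n ! s + j ! s < m ! s * n ! s" if "s < length n" for s
  proof -
    have "i ! s * n ! s + j ! s < Suc (i ! s) * n ! s" using a[OF that] by simp
    also have "\<dots> \<le> m ! s * n ! s" using a[OF that] by (intro mult_le_mono1) simp
    finally show ?thesis .
  qed
  then have "?k \<in> multi_indices (map2 (*) m n)"
    using li lj l by (auto simp: multi_indices_def)
  moreover have "map2 (div) ?k n = i"
    using li lj dv by (intro nth_equalityI) auto
  moreover have "map2 (mod) ?k n = j"
    using li lj a by (intro nth_equalityI) auto
  ultimately show ?thesis by (simp add: paired_kron_def)
qed

lemma kron_unit_vecs:
  assumes "k \<in> multi_indices q"
  shows "kron_vecs (map2 unit_vec q k) =
         vec (prod_list q) (\<lambda>c. if multi_index_list q ! c = k then 1 else 0)"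
  using assms
proof (induction q arbitrary: k)
  case Nil
  then show ?case
    by (auto simp: kron_vecs_def multi_indices_def multi_index_list_def)
next
  case (Cons r q)
  obtain x k' where k: "k = x # k'" "x < r" "k' \<in> multi_indices q"
    using Cons.prems by (cases k) (auto simp: multi_indices_Cons, simp add: multi_indices_def)
  have IH: "kron_vecs (map2 unit_vec q k') =
      vec (prod_list q) (\<lambda>c. if multi_index_list q ! c = k' then 1 else 0)"
    using Cons.IH k by simp
  have "kron_vecs (map2 unit_vec (r # q) k) =
      kron_vec (unit_vec r x) (kron_vecs (map2 unit_vec q k'))"
    using k by (simp add: kron_vecs_def)
  also have "\<dots> = vec (prod_list (r # q))
      (\<lambda>c. if multi_index_list (r # q) ! c = k then 1 else 0)"
  proof (rule eq_vecI)
    fix c assume "c < dim_vec (vec (prod_list (r # q))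
      (\<lambda>c. if multi_index_list (r # q) ! c = k then 1 else (0::real)))"
    then have c: "c < r * prod_list q" by simp
    then have "0 < prod_list q" by (cases "prod_list q") auto
    moreover have "c div prod_list q < r" using c by (simp add: less_mult_imp_div_less)
    ultimately show "kron_vec (unit_vec r x) (kron_vecs (map2 unit_vec q k')) $ c =
      vec (prod_list (r # q)) (\<lambda>c. if multi_index_list (r # q) ! c = k then 1 else 0) $ c"
      using c k by (auto simp: kron_vec_def IH nth_multi_index_list_Cons)
  qed (simp add: kron_vec_def IH)
  finally show ?case .
qed

lemma prod_list_splice: "prod_list (splice xs ys) = prod_list xs * prod_list (ys :: nat list)"
  by (induction xs ys rule: splice.induct) (simp_all add: ac_simps)

lemma splice_in_multi_indices:
  assumes "length m = length n" "i \<in> multi_indices m" "j \<in> multi_indices n"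
  shows "splice i j \<in> multi_indices (splice m n)"
    and "splice (map2 unit_vec m i) (map2 unit_vec n j) =
         (map2 unit_vec (splice m n) (splice i j) :: real vec list)"
proof -
  have l: "length i = length m" "length j = length n"
    using assms by (auto simp: multi_indices_def)
  have "splice i j \<in> multi_indices (splice m n) \<and>
      splice (map2 unit_vec m i) (map2 unit_vec n j) =
      (map2 unit_vec (splice m n) (splice i j) :: real vec list)"
    using assms(1) l assms(2,3)
  proof (induction m n arbitrary: i j rule: list_induct2)
    case Nil
    then show ?case by simp
  next
    case (Cons a m b n)
    obtain x i' where i: "i = x # i'" using Cons.prems by (cases i) auto
    obtain y j' where j: "j = y # j'" using Cons.prems by (cases j) auto
    show ?case using Cons i j by (simp add: multi_indices_Cons)
  qed
  then show "splice i j \<in> multi_indices (splice m n)"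
    and "splice (map2 unit_vec m i) (map2 unit_vec n j) =
         (map2 unit_vec (splice m n) (splice i j) :: real vec list)" by auto
qed

lemma Psi_kron_unit_vecs:
  assumes l: "length m = length n" and i: "i \<in> multi_indices m" and j: "j \<in> multi_indices n"
  shows "Psi m n *\<^sub>v kron_vecs (map2 unit_vec m i @ map2 unit_vec n j) =
         kron_vecs (splice (map2 unit_vec m i) (map2 unit_vec n j))"
proof -
  let ?L = "multi_index_list (m @ n)" and ?N = "prod_list m * prod_list n"
  have li: "length i = length m" "length j = length n"
    using i j by (auto simp: multi_indices_def)
  have ij: "i @ j \<in> multi_indices (m @ n)"
    using i j by (auto simp: multi_indices_def nth_append)
  have "map2 unit_vec m i @ map2 unit_vec n j = (map2 unit_vec (m @ n) (i @ j) :: real vec list)"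
    using li by simp
  then have v: "kron_vecs (map2 unit_vec m i @ map2 unit_vec n j) =
      vec ?N (\<lambda>c. if ?L ! c = i @ j then 1 else 0)"
    using kron_unit_vecs[OF ij] by simp
  obtain c0 where c0: "c0 < ?N" "?L ! c0 = i @ j"
    using ij by (metis set_multi_index_list in_set_conv_nth length_multi_index_list
        prod_list.append)
  have uniq: "?L ! c = i @ j \<longleftrightarrow> c = c0" if "c < ?N" for c
    using that c0 distinct_multi_index_list[of "m @ n"]
    by (metis nth_eq_iff_index_eq length_multi_index_list prod_list.append)
  have w: "kron_vecs (splice (map2 unit_vec m i) (map2 unit_vec n j)) =
      vec ?N (\<lambda>r. if multi_index_list (splice m n) ! r = splice i j then 1 else 0)"
    using kron_unit_vecs[OF splice_in_multi_indices(1)[OF l i j]]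
      splice_in_multi_indices(2)[OF l i j]
    by (simp add: prod_list_splice)
  show ?thesis
  proof (rule eq_vecI)
    fix r assume "r < dim_vec (kron_vecs (splice (map2 unit_vec m i) (map2 unit_vec n j)))"
    then have r: "r < ?N" by (simp add: w)
    have "(Psi m n *\<^sub>v kron_vecs (map2 unit_vec m i @ map2 unit_vec n j)) $ r =
        (\<Sum>c = 0..<?N. Psi m n $$ (r, c) * (if ?L ! c = i @ j then 1 else 0))"
      using r by (simp add: v Psi_def scalar_prod_def)
    also have "\<dots> = (\<Sum>c = 0..<?N. if c = c0 then Psi m n $$ (r, c) else 0)"
      by (intro sum.cong) (auto simp: uniq)
    also have "\<dots> = Psi m n $$ (r, c0)" using c0 by simp
    also have "\<dots> = (if multi_index_list (splice m n) ! r = splice i j then 1 else 0)"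
      using r c0 li by (simp add: Psi_def)
    finally show "(Psi m n *\<^sub>v kron_vecs (map2 unit_vec m i @ map2 unit_vec n j)) $ r =
        kron_vecs (splice (map2 unit_vec m i) (map2 unit_vec n j)) $ r"
      using r by (simp add: w)
  qed (simp add: w Psi_def)
qed

end

theory Submission
  imports Defs
begin

text \<open>
  \<open>\<Psi>\<^sup>T\<close> only reorders entries: the entry of \<open>\<Psi>\<^sup>T V(A)\<close> at the position of
  \<open>(i\<^sub>1, ..., i\<^sub>d, j\<^sub>1, ..., j\<^sub>d)\<close> is the entry of \<open>A\<close> at \<open>k\<^sub>s = i\<^sub>s n\<^sub>s + j\<^sub>s\<close>, because the
  mixed-radix digits of a position with respect to \<open>q\<close> split into those with respect to
  \<open>(m\<^sub>1, n\<^sub>1, ..., m\<^sub>d, n\<^sub>d)\<close>. Hence \<open>\<Psi>\<^sup>T V(B \<otimes>\<^sub>d C) = V(B) \<otimes> V(C)\<close>, and since every vector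
  is the vector form of a hypermatrix, a decomposition of \<open>\<Psi>\<^sup>T V(A)\<close> is one of \<open>A\<close>.
\<close>

text \<open>Kept literally equal to the index expression in \<open>paired_kron_apply\<close>, so
  that unfolding it makes that lemma applicable.\<close>

definition pair_index :: "nat list \<Rightarrow> nat list \<Rightarrow> nat list \<Rightarrow> nat list" where
  "pair_index n i j = map2 (\<lambda>(i, j) n. i * n + j) (zip i j) n"

lemma length_multi_indices: "k \<in> multi_indices q \<Longrightarrow> length k = length q"
  by (simp add: multi_indices_def)

lemma nth_multi_index_list_in: "r < prod_list q \<Longrightarrow> multi_index_list q ! r \<in> multi_indices q"
  by (metis length_multi_index_list nth_mem set_multi_index_list)

lemma multi_index_list_position:
  assumes "k \<in> multi_indices q"
  obtains r where "r < prod_list q" "multi_index_list q ! r = k"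
  using assms by (metis in_set_conv_nth length_multi_index_list set_multi_index_list)

lemma multi_index_list_inj:
  assumes "r < prod_list q" "r' < prod_list q"
  shows "multi_index_list q ! r = multi_index_list q ! r' \<longleftrightarrow> r = r'"
  using assms distinct_multi_index_list length_multi_index_list by (simp add: nth_eq_iff_index_eq)

text \<open>In a mixed-radix expansion the leading digits encode the quotient, and the trailing ones
  the remainder, by the product of the trailing radices. Induction on \<open>m\<close> peels off the
  first digit. The \<open>div\<close>/\<open>mod\<close> form describes the columns of
  \<open>Psi\<close> and matches the indexing in \<open>kron_vec\<close>.\<close>

lemma nth_multi_index_list_append:
  assumes "c < prod_list m * prod_list n"
  shows "multi_index_list (m @ n) ! c =
    multi_index_list m ! (c div prod_list n) @ multi_index_list n ! (c mod prod_list n)"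
  using assms
proof (induction m arbitrary: c)
  case Nil
  then show ?case by (simp add: multi_index_list_def)
next
  case (Cons a m)
  let ?M = "prod_list m" and ?N = "prod_list n"
  have c: "c < a * (?M * ?N)" using Cons.prems by (simp add: mult.assoc)
  then have pos: "0 < ?M * ?N" by (cases "?M * ?N") auto
  have "c div ?N < a * ?M"
    using Cons.prems by (simp add: less_mult_imp_div_less)
  moreover have "c mod (?M * ?N) div ?N = c div ?N mod ?M"
    by (cases "?N = 0") (simp_all add: mult.commute[of ?M] mod_mult2_eq)
  moreover have "c mod (?M * ?N) mod ?N = c mod ?N"
    by (simp add: mod_mod_cancel)
  moreover have "c div (?M * ?N) = c div ?N div ?M"
    by (simp add: div_mult2_eq mult.commute[of ?M])
  ultimately show ?case
    using c pos Cons.IH[of "c mod (?M * ?N)"] by (simp add: nth_multi_index_list_Cons)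
qed

lemma prod_list_map2_mult:
  "length m = length n \<Longrightarrow> prod_list (map2 (*) m n) = prod_list m * (prod_list n :: nat)"
  by (induction m n rule: list_induct2) (simp_all add: ac_simps)

lemma nth_multi_index_list_splice:
  assumes "length m = length n" and "r < prod_list m * prod_list n"
    and "k = multi_index_list (map2 (*) m n) ! r"
  shows "multi_index_list (splice m n) ! r = splice (map2 (div) k n) (map2 (mod) k n)"
  using assms
proof (induction m n arbitrary: r k rule: list_induct2)
  case Nil
  then show ?case by (simp add: multi_index_list_def)
next
  case (Cons a m b n)
  let ?P = "prod_list (splice m n)"
  have P: "prod_list m * prod_list n = ?P" by (simp add: prod_list_splice)
  have Q: "prod_list (map2 (*) m n) = ?P"
    using prod_list_map2_mult[OF Cons.hyps] P by simp
  \<comment> \<open>The first bracketing serves to peel two digits off the spliced index, the second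
    to peel one off \<open>k\<close>.\<close>
  have r: "r < a * (b * ?P)" "r < a * b * ?P"
    using Cons.prems(1) by (simp_all add: P[symmetric] ac_simps)
  then have pos: "0 < b * ?P" by (cases "b * ?P") auto
  have "multi_index_list (splice (a # m) (b # n)) ! r =
    r div (b * ?P) # (r mod (b * ?P)) div ?P # multi_index_list (splice m n) ! (r mod ?P)"
    using r pos by (simp add: nth_multi_index_list_Cons mod_mod_cancel)
  moreover have "k = r div ?P # multi_index_list (map2 (*) m n) ! (r mod ?P)"
    using r Cons.prems(2) by (simp add: nth_multi_index_list_Cons Q)
  moreover have "r div (b * ?P) = r div ?P div b"
    by (simp add: div_mult2_eq mult.commute[of b])
  moreover have "r mod (b * ?P) div ?P = r div ?P mod b"
    using pos by (simp add: mult.commute[of b] mod_mult2_eq)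
  ultimately show ?case
    using Cons.IH[of "r mod ?P"] pos by (simp add: P)
qed

lemma pair_index_div_mod:
  assumes "i \<in> multi_indices m" "j \<in> multi_indices n" "length m = length n"
  shows "map2 (div) (pair_index n i j) n = i"
    and "map2 (mod) (pair_index n i j) n = j"
proof -
  have l: "length i = length n" "length j = length n"
    and j: "\<And>s. s < length n \<Longrightarrow> j ! s < n ! s"
    using assms by (auto simp: multi_indices_def)
  have "(i ! s * n ! s + j ! s) div n ! s = i ! s" if "s < length n" for s
    using j[OF that] by (subst div_mult_self3) auto
  with l j show "map2 (div) (pair_index n i j) n = i" and "map2 (mod) (pair_index n i j) n = j"
    unfolding pair_index_def by (auto intro!: nth_equalityI)
qed

lemma pair_index_in:
  assumes "i \<in> multi_indices m" "j \<in> multi_indices n" "length m = length n"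
  shows "pair_index n i j \<in> multi_indices (map2 (*) m n)"
proof -
  have "x * b + y < a * b" if "x < a" "y < b" for x y a b :: nat
  proof -
    have "x * b + y < Suc x * b" using that by simp
    also have "\<dots> \<le> a * b" using that by (intro mult_le_mono1) simp
    finally show ?thesis .
  qed
  with assms show ?thesis by (auto simp: multi_indices_def pair_index_def)
qed

lemma div_mod_in_multi_indices:
  assumes "k \<in> multi_indices (map2 (*) m n)" "length m = length n"
  shows "map2 (div) k n \<in> multi_indices m" and "map2 (mod) k n \<in> multi_indices n"
proof -
  have l: "length k = length n" and k: "\<And>s. s < length n \<Longrightarrow> k ! s < m ! s * n ! s"
    using assms by (auto simp: multi_indices_def)
  \<comment> \<open>A zero size would leave no value for \<open>k ! s\<close>; positivity is what
    bounds the remainder.\<close>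
  have "0 < n ! s" if "s < length n" for s
    using k[OF that] by (cases "n ! s") auto
  with l k assms(2) show "map2 (div) k n \<in> multi_indices m" "map2 (mod) k n \<in> multi_indices n"
    by (auto simp: multi_indices_def less_mult_imp_div_less)
qed

lemma pair_index_of_div_mod:
  assumes "length k = length n"
  shows "pair_index n (map2 (div) k n) (map2 (mod) k n) = k"
  using assms unfolding pair_index_def
  by (auto intro!: nth_equalityI simp: div_mult_mod_eq)

lemma vector_form_index:
  "r < prod_list q \<Longrightarrow> vector_form q A $ r = A (multi_index_list q ! r)"
  by (simp add: vector_form_def length_multi_index_list vec_of_list_index)

lemma vector_form_surj:
  assumes "y \<in> carrier_vec (prod_list q)"
  obtains B where "B \<in> hypermatrices q" "vector_form q B = y"
proof
  let ?L = "multi_index_list q"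
  \<comment> \<open>Each multi-index occupies exactly one position, so its entry can be read back
    from \<open>y\<close>; the restricted abstraction makes \<open>?B\<close> extensional.\<close>
  let ?B = "\<lambda>k\<in>multi_indices q. y $ (THE r. r < prod_list q \<and> ?L ! r = k)"
  show "?B \<in> hypermatrices q" by (simp add: hypermatrices_def)
  show "vector_form q ?B = y"
  proof (rule eq_vecI)
    fix r assume "r < dim_vec y"
    then have r: "r < prod_list q" using assms by simp
    then have "(THE r'. r' < prod_list q \<and> ?L ! r' = ?L ! r) = r"
      by (auto simp: multi_index_list_inj)
    with r show "vector_form q ?B $ r = y $ r"
      by (simp add: vector_form_index nth_multi_index_list_in)
  qed (use assms in \<open>simp add: dim_vector_form\<close>)
qed

text \<open>Row \<open>c\<close> of the transpose is column \<open>c\<close> of \<open>Psi\<close>,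
  which has a single 1. Its row is the position of the paired index, because the spliced enumeration
  has \<open>splice ?i ?j\<close> there.\<close>

lemma Psi_transpose_vector_form_index:
  assumes l: "length m = length n" and c: "c < prod_list m * prod_list n"
  shows "(transpose_mat (Psi m n) *\<^sub>v vector_form (map2 (*) m n) A) $ c =
    A (pair_index n (multi_index_list m ! (c div prod_list n))
         (multi_index_list n ! (c mod prod_list n)))"
proof -
  let ?N = "prod_list m * prod_list n" and ?q = "map2 (*) m n"
  let ?i = "multi_index_list m ! (c div prod_list n)"
  let ?j = "multi_index_list n ! (c mod prod_list n)"
  let ?k = "pair_index n ?i ?j"
  have q: "prod_list ?q = ?N" using l by (rule prod_list_map2_mult)
  have "0 < prod_list n" using c by (cases "prod_list n") auto
  then have i: "?i \<in> multi_indices m" and j: "?j \<in> multi_indices n"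
    using c by (simp_all add: nth_multi_index_list_in less_mult_imp_div_less)
  have li: "length ?i = length n" "length ?j = length n"
    using length_multi_indices[OF i] length_multi_indices[OF j] l by simp_all
  obtain r0 where r0: "r0 < ?N" "multi_index_list ?q ! r0 = ?k"
    using multi_index_list_position[OF pair_index_in[OF i j l]] q by auto
  have splice_r0: "multi_index_list (splice m n) ! r0 = splice ?i ?j"
    using nth_multi_index_list_splice[OF l r0(1) r0(2)[symmetric]]
    by (simp add: pair_index_div_mod[OF i j l])
  have entry: "Psi m n $$ (r, c) = (if r = r0 then 1 else 0)" if "r < ?N" for r
  proof -
    \<comment> \<open>The enumeration has no repetitions, so no other row of this column
      matches.\<close>
    have "multi_index_list (splice m n) ! r = splice ?i ?j \<longleftrightarrow> r = r0"
      using multi_index_list_inj[of r "splice m n" r0] that r0(1) splice_r0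
      by (simp add: prod_list_splice)
    with that c li l show ?thesis
      by (simp add: Psi_def nth_multi_index_list_append)
  qed
  have "(transpose_mat (Psi m n) *\<^sub>v vector_form ?q A) $ c =
      (\<Sum>r = 0..<?N. Psi m n $$ (r, c) * vector_form ?q A $ r)"
    using c q by (simp add: Psi_def scalar_prod_def dim_vector_form)
  also have "\<dots> = (\<Sum>r = 0..<?N. if r = r0 then vector_form ?q A $ r else 0)"
    by (intro sum.cong) (auto simp: entry)
  also have "\<dots> = A ?k" using r0 q by (simp add: vector_form_index)
  finally show ?thesis .
qed

lemma Psi_transpose_paired_kron:
  assumes l: "length m = length n"
  shows "transpose_mat (Psi m n) *\<^sub>v vector_form (map2 (*) m n) (paired_kron m n B C) =
    kron_vec (vector_form m B) (vector_form n C)"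
proof (rule eq_vecI)
  fix c assume "c < dim_vec (kron_vec (vector_form m B) (vector_form n C))"
  then have c: "c < prod_list m * prod_list n" by (simp add: kron_vec_def dim_vector_form)
  then have "0 < prod_list n" by (cases "prod_list n") auto
  with c have "c div prod_list n < prod_list m" "c mod prod_list n < prod_list n"
    by (simp_all add: less_mult_imp_div_less)
  with c l show "(transpose_mat (Psi m n) *\<^sub>v
      vector_form (map2 (*) m n) (paired_kron m n B C)) $ c =
      kron_vec (vector_form m B) (vector_form n C) $ c"
    by (simp add: Psi_transpose_vector_form_index pair_index_def paired_kron_apply
        nth_multi_index_list_in kron_vec_def dim_vector_form vector_form_index)
qed (simp add: Psi_def kron_vec_def dim_vector_form)

text \<open>This gives the converse direction without inverting \<open>Psi\<close>: every
  \<open>k\<close> is the paired index of its quotients and remainders, so every entry of a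
  hypermatrix occurs somewhere in the reordered vector.\<close>

lemma Psi_transpose_vector_form_inj:
  assumes l: "length m = length n"
    and A: "A \<in> hypermatrices (map2 (*) m n)" and A': "A' \<in> hypermatrices (map2 (*) m n)"
    and eq: "transpose_mat (Psi m n) *\<^sub>v vector_form (map2 (*) m n) A =
      transpose_mat (Psi m n) *\<^sub>v vector_form (map2 (*) m n) A'"
  shows "A = A'"
proof (rule PiE_ext[OF A[unfolded hypermatrices_def] A'[unfolded hypermatrices_def]])
  fix k assume k: "k \<in> multi_indices (map2 (*) m n)"
  obtain a where a: "a < prod_list m" "multi_index_list m ! a = map2 (div) k n"
    using multi_index_list_position[OF div_mod_in_multi_indices(1)[OF k l]] .
  obtain b where b: "b < prod_list n" "multi_index_list n ! b = map2 (mod) k n"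
    using multi_index_list_position[OF div_mod_in_multi_indices(2)[OF k l]] .
  \<comment> \<open>The position whose quotient and remainder by \<open>prod_list n\<close> are
    \<open>a\<close> and \<open>b\<close>, hence that of the concatenated multi-index.\<close>
  let ?c = "a * prod_list n + b"
  have "?c < Suc a * prod_list n" using b by simp
  also have "\<dots> \<le> prod_list m * prod_list n" using a by (intro mult_le_mono1) simp
  finally have c: "?c < prod_list m * prod_list n" .
  have "length k = length n" using k l by (auto simp: multi_indices_def)
  then have "(transpose_mat (Psi m n) *\<^sub>v vector_form (map2 (*) m n) F) $ ?c = F k" for F
    using Psi_transpose_vector_form_index[OF l c, of F] a b
    by (simp add: pair_index_of_div_mod)
  with eq show "A k = A' k" by metis
qed

theorem mainTheorem4:
  fixes d :: nat and m n q :: "nat list" and A :: "nat list \<Rightarrow> real"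
  assumes "d \<ge> 1"
    and "length m = d" and "length n = d"
    and "\<forall>k<d. m ! k > 0" and "\<forall>k<d. n ! k > 0"
    and "q = map2 (*) m n"
    and "A \<in> hypermatrices q"
  shows "(\<exists>B\<in>hypermatrices m. \<exists>C\<in>hypermatrices n. A = paired_kron m n B C) \<longleftrightarrow>
         decomposable (prod_list m) (prod_list n) (transpose_mat (Psi m n) *\<^sub>v vector_form q A)"
proof
  have l: "length m = length n" using assms by simp
  {
    assume "\<exists>B\<in>hypermatrices m. \<exists>C\<in>hypermatrices n. A = paired_kron m n B C"
    then obtain B C where "A = paired_kron m n B C" by blast
    then have "transpose_mat (Psi m n) *\<^sub>v vector_form q A =
        kron_vec (vector_form m B) (vector_form n C)"
      using Psi_transpose_paired_kron[OF l] assms(6) by simp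
    moreover have "vector_form m B \<in> carrier_vec (prod_list m)"
      "vector_form n C \<in> carrier_vec (prod_list n)"
      by (simp_all add: carrier_vecI dim_vector_form)
    ultimately show "decomposable (prod_list m) (prod_list n)
        (transpose_mat (Psi m n) *\<^sub>v vector_form q A)"
      unfolding decomposable_def by blast
  next
    assume "decomposable (prod_list m) (prod_list n)
        (transpose_mat (Psi m n) *\<^sub>v vector_form q A)"
    then obtain y z where yz: "y \<in> carrier_vec (prod_list m)" "z \<in> carrier_vec (prod_list n)"
      "transpose_mat (Psi m n) *\<^sub>v vector_form q A = kron_vec y z"
      unfolding decomposable_def by blast
    obtain B where B: "B \<in> hypermatrices m" "vector_form m B = y"
      using vector_form_surj[OF yz(1)] .
    obtain C where C: "C \<in> hypermatrices n" "vector_form n C = z"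
      using vector_form_surj[OF yz(2)] .
    \<comment> \<open>Both sides are reordered to \<open>kron_vec y z\<close>, by the choice of
      \<open>B\<close> and \<open>C\<close>, so injectivity identifies them.\<close>
    have "A = paired_kron m n B C"
    proof (rule Psi_transpose_vector_form_inj[OF l])
      show "A \<in> hypermatrices (map2 (*) m n)" using assms(6,7) by simp
      show "paired_kron m n B C \<in> hypermatrices (map2 (*) m n)"
        by (simp add: hypermatrices_def paired_kron_def)
      show "transpose_mat (Psi m n) *\<^sub>v vector_form (map2 (*) m n) A =
          transpose_mat (Psi m n) *\<^sub>v vector_form (map2 (*) m n) (paired_kron m n B C)"
        using yz(3) B(2) C(2) assms(6) Psi_transpose_paired_kron[OF l] by simp
    qed
    with B(1) C(1) show "\<exists>B\<in>hypermatrices m. \<exists>C\<in>hypermatrices n. A = paired_kron m n B C"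
      by blast
  }
qed

end
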